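(* For any sum-symmetric $n\times n$ matrix $A$, i.e. any $n\times n$ matrix $A$ with $r_i(A)=c_i(A)$ for all $i\in\{1,\ldots,n\}$, we have \[ \operatorname{sum}(A)^2\le n\cdot\operatorname{sum}(A^2). \]
   Context: Matrices are $n\times n$ matrices $A$ with entries $a_{ij}$. The total sum of the entries of $A$ is denoted by $\operatorname{sum}(A)=\sum_{i,j=1}^n a_{ij}$, the $i$-th row sum by $r_i(A)=\sum_{j=1}^n a_{ij}$, and the $j$-th column sum by $c_j(A)=\sum_{i=1}^n a_{ij}$. $A^2$ denotes the matrix product $A\cdot A$, and $\operatorname{sum}(A^2)$ the total sum of its entries. *)

theory Defs
  imports "HOL-Analysis.Analysis"
begin

definition mat_sum :: "real ^ 'n ^ 'n \<Rightarrow> real" where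
  "mat_sum A = (\<Sum>i\<in>UNIV. \<Sum>j\<in>UNIV. A $ i $ j)"

definition row_sum :: "real ^ 'n ^ 'n \<Rightarrow> 'n \<Rightarrow> real" where
  "row_sum A i = (\<Sum>j\<in>UNIV. A $ i $ j)"

definition col_sum :: "real ^ 'n ^ 'n \<Rightarrow> 'n \<Rightarrow> real" where
  "col_sum A j = (\<Sum>i\<in>UNIV. A $ i $ j)"

definition sum_symmetric :: "real ^ 'n ^ 'n \<Rightarrow> bool" where
  "sum_symmetric A \<longleftrightarrow> (\<forall>i. row_sum A i = col_sum A i)"

end

theory Submission
  imports Defs
begin

text \<open>Grouping the entries of a matrix product by the inner index k gives sum(AB) = \<Sum>k.
  c_k(A) r_k(B), which is \<open>mat_sum_matrix_mult\<close>. If A is sum-symmetric, sum(A^2) is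
  therefore the sum of the squared row sums, while sum(A) is the sum of the row sums; Cauchy-Schwarz
  against the all-ones vector compares the two.\<close>

lemma mat_sum_matrix_mult:
  "mat_sum (A ** B) = (\<Sum>k\<in>UNIV. col_sum A k * row_sum B k)"
proof -
  have "mat_sum (A ** B) = (\<Sum>i\<in>UNIV. \<Sum>j\<in>UNIV. \<Sum>k\<in>UNIV. A $ i $ k * B $ k $ j)"
    by (simp add: mat_sum_def matrix_matrix_mult_def)
  also have "\<dots> = (\<Sum>i\<in>UNIV. \<Sum>k\<in>UNIV. \<Sum>j\<in>UNIV. A $ i $ k * B $ k $ j)"
    by (intro sum.cong refl sum.swap)
  also have "\<dots> = (\<Sum>k\<in>UNIV. \<Sum>i\<in>UNIV. \<Sum>j\<in>UNIV. A $ i $ k * B $ k $ j)"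
    by (rule sum.swap)
  \<comment> \<open>For fixed k the summand separates into a factor in i and a factor in j.\<close>
  also have "\<dots> = (\<Sum>k\<in>UNIV. col_sum A k * row_sum B k)"
    by (simp add: col_sum_def row_sum_def sum_product)
  finally show ?thesis .
qed

theorem mainTheorem2:
  fixes A :: "real ^ 'n ^ 'n"
  assumes "sum_symmetric A"
  shows "(mat_sum A)\<^sup>2 \<le> real CARD('n) * mat_sum (A ** A)"
proof -
  have "(mat_sum A)\<^sup>2 = (\<Sum>k\<in>UNIV. row_sum A k)\<^sup>2"
    by (simp add: mat_sum_def row_sum_def)
  also have "\<dots> \<le> (\<Sum>k\<in>UNIV. (row_sum A k)\<^sup>2) * real CARD('n)"
    by (rule sum_squared_le_sum_of_squares)
  \<comment> \<open>Sum-symmetry turns each product c_k(A) r_k(A) into a square.\<close>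
  also have "(\<Sum>k\<in>UNIV. (row_sum A k)\<^sup>2) = mat_sum (A ** A)"
    using assms by (simp add: mat_sum_matrix_mult sum_symmetric_def power2_eq_square)
  finally show ?thesis
    by (simp add: mult.commute)
qed

end
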